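(* Let $(X,\tau)$ and $(Y,\sigma)$ be topological spaces and let $f \colon (X,\tau) \rightarrow (Y,\sigma)$ be a function. The following conditions are equivalent: (1) $f$ is $SR$-continuous. (2) $f$ is $\beta$-continuous, simply-continuous and contra-sg-continuous.
   Context: No separation axioms are assumed and functions are not assumed continuous. For a subset $A$ of a topological space, $\mathrm{Int}(A)$ and $\mathrm{Cl}(A)$ denote interior and closure. $A$ is semi-open if $A \subseteq \mathrm{Cl}(\mathrm{Int}(A))$; semi-closed if its complement is semi-open (equivalently $\mathrm{Int}(\mathrm{Cl}(A)) \subseteq A$); semi-regular if it is both semi-open and semi-closed; $\beta$-open if $A \subseteq \mathrm{Cl}(\mathrm{Int}(\mathrm{Cl}(A)))$. $A$ is simply-open if $A = U \cup N$ with $U$ open and $N$ nowhere dense. The semi-closure $\mathrm{sCl}(A)$ is the intersection of all semi-closed sets containing $A$. $A$ is sg-closed if $\mathrm{sCl}(A) \subseteq U$ whenever $A \subseteq U$ and $U$ is semi-open. A function $f \colon (X,\tau)\to(Y,\sigma)$ is $SR$-continuous (resp. $\beta$-continuous, simply-continuous, contra-sg-continuous) if the preimage of every open subset of $Y$ is semi-regular (resp. $\beta$-open, simply-open, sg-closed) in $X$. *)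

theory Defs
  imports "HOL-Analysis.Analysis"
begin

definition semi_open :: "'a topology \<Rightarrow> 'a set \<Rightarrow> bool" where
  "semi_open X A \<longleftrightarrow> A \<subseteq> topspace X \<and> A \<subseteq> X closure_of (X interior_of A)"

definition semi_closed :: "'a topology \<Rightarrow> 'a set \<Rightarrow> bool" where
  "semi_closed X A \<longleftrightarrow> A \<subseteq> topspace X \<and> semi_open X (topspace X - A)"

definition semi_regular :: "'a topology \<Rightarrow> 'a set \<Rightarrow> bool" where
  "semi_regular X A \<longleftrightarrow> semi_open X A \<and> semi_closed X A"

definition beta_open :: "'a topology \<Rightarrow> 'a set \<Rightarrow> bool" where
  "beta_open X A \<longleftrightarrow>
     A \<subseteq> topspace X \<and> A \<subseteq> X closure_of (X interior_of (X closure_of A))"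

definition nowhere_dense :: "'a topology \<Rightarrow> 'a set \<Rightarrow> bool" where
  "nowhere_dense X A \<longleftrightarrow> A \<subseteq> topspace X \<and> X interior_of (X closure_of A) = {}"

definition simply_open :: "'a topology \<Rightarrow> 'a set \<Rightarrow> bool" where
  "simply_open X A \<longleftrightarrow> (\<exists>U N. openin X U \<and> nowhere_dense X N \<and> A = U \<union> N)"

(* Intended for A \<subseteq> topspace X; then topspace X belongs to the family, so the
   intersection is not over an empty family. *)
definition semi_closure :: "'a topology \<Rightarrow> 'a set \<Rightarrow> 'a set" where
  "semi_closure X A = \<Inter>{C. semi_closed X C \<and> A \<subseteq> C}"

definition sg_closed :: "'a topology \<Rightarrow> 'a set \<Rightarrow> bool" where
  "sg_closed X A \<longleftrightarrow>
     A \<subseteq> topspace X \<and> (\<forall>U. semi_open X U \<and> A \<subseteq> U \<longrightarrow> semi_closure X A \<subseteq> U)"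

(* The following constrain only preimages of open sets; that f maps topspace X into
   topspace Y is a separate hypothesis wherever they are used. *)

definition SR_continuous :: "'a topology \<Rightarrow> 'b topology \<Rightarrow> ('a \<Rightarrow> 'b) \<Rightarrow> bool" where
  "SR_continuous X Y f \<longleftrightarrow>
     (\<forall>V. openin Y V \<longrightarrow> semi_regular X {x \<in> topspace X. f x \<in> V})"

definition beta_continuous :: "'a topology \<Rightarrow> 'b topology \<Rightarrow> ('a \<Rightarrow> 'b) \<Rightarrow> bool" where
  "beta_continuous X Y f \<longleftrightarrow>
     (\<forall>V. openin Y V \<longrightarrow> beta_open X {x \<in> topspace X. f x \<in> V})"

definition simply_continuous :: "'a topology \<Rightarrow> 'b topology \<Rightarrow> ('a \<Rightarrow> 'b) \<Rightarrow> bool" where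
  "simply_continuous X Y f \<longleftrightarrow>
     (\<forall>V. openin Y V \<longrightarrow> simply_open X {x \<in> topspace X. f x \<in> V})"

definition contra_sg_continuous :: "'a topology \<Rightarrow> 'b topology \<Rightarrow> ('a \<Rightarrow> 'b) \<Rightarrow> bool" where
  "contra_sg_continuous X Y f \<longleftrightarrow>
     (\<forall>V. openin Y V \<longrightarrow> sg_closed X {x \<in> topspace X. f x \<in> V})"

end

theory Submission
  imports Defs
begin

text \<open>The equivalence holds set by set, for each preimage of an open set
  (\<open>semi_regular_iff\<close>). Two facts carry it. First, semi-open amounts to \<beta>-open
  plus simply-open: a semi-open set differs from its interior by part of the boundary of that
  interior, while in a simply-open set the nowhere dense part cannot enlarge the interior of the
  closure beyond the closure of the open part. Second, for a semi-open set, sg-closed amounts to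
  semi-closed, because the set can be tested against itself.\<close>

lemma semi_open_Union:
  assumes "\<And>A. A \<in> \<A> \<Longrightarrow> semi_open X A"
  shows "semi_open X (\<Union>\<A>)"
  unfolding semi_open_def
proof (intro conjI Union_least)
  fix A assume A: "A \<in> \<A>"
  then show "A \<subseteq> topspace X"
    using assms unfolding semi_open_def by blast
  have "X closure_of (X interior_of A) \<subseteq> X closure_of (X interior_of \<Union>\<A>)"
    using A by (intro closure_of_mono interior_of_mono) blast
  then show "A \<subseteq> X closure_of (X interior_of \<Union>\<A>)"
    using assms[OF A] unfolding semi_open_def by blast
qed

text \<open>By De Morgan the complement is a union of semi-open sets, so
  \<open>semi_open_Union\<close> applies.\<close>

lemma semi_closed_semi_closure:
  assumes "A \<subseteq> topspace X"
  shows "semi_closed X (semi_closure X A)"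
proof -
  let ?\<C> = "{C. semi_closed X C \<and> A \<subseteq> C}"
  \<comment> \<open>A nonempty family keeps the intersection inside the space.\<close>
  have "topspace X \<in> ?\<C>"
    using assms by (simp add: semi_closed_def semi_open_def)
  then have "semi_closure X A \<subseteq> topspace X"
    unfolding semi_closure_def by blast
  moreover have "semi_open X (\<Union>C\<in>?\<C>. topspace X - C)"
    by (rule semi_open_Union) (auto simp: semi_closed_def)
  moreover have "topspace X - semi_closure X A = (\<Union>C\<in>?\<C>. topspace X - C)"
    unfolding semi_closure_def by blast
  ultimately show ?thesis
    by (simp add: semi_closed_def)
qed

lemma semi_closed_imp_sg_closed: "semi_closed X A \<Longrightarrow> sg_closed X A"
  unfolding sg_closed_def semi_closure_def semi_closed_def by blast

text \<open>Taking \<open>U = A\<close> in the definition of sg-closed forces \<open>A\<close> to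
  equal its semi-closure.\<close>

lemma semi_open_sg_closed_imp_semi_closed:
  assumes "semi_open X A" and "sg_closed X A"
  shows "semi_closed X A"
proof -
  have "semi_closure X A = A"
    using assms unfolding sg_closed_def semi_closure_def by blast
  then show ?thesis
    using assms semi_closed_semi_closure[of A X] by (simp add: sg_closed_def)
qed

lemma semi_open_imp_beta_open:
  assumes "semi_open X A"
  shows "beta_open X A"
proof -
  have "A \<subseteq> X closure_of A"
    using assms by (simp add: semi_open_def closure_of_subset)
  then have "X closure_of (X interior_of A)
      \<subseteq> X closure_of (X interior_of (X closure_of A))"
    by (intro closure_of_mono interior_of_mono)
  then show ?thesis
    using assms unfolding semi_open_def beta_open_def by blast
qed

text \<open>This is the boundary of an open set. It is closed, so only its interior matters; that
  interior is an open set missing \<open>U\<close>, hence missing the closure of \<open>U\<close>,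
  in which it lies.\<close>

lemma nowhere_dense_closure_of_diff:
  assumes "openin X U"
  shows "nowhere_dense X (X closure_of U - U)"
proof -
  let ?F = "X closure_of U - U"
  have closed: "closedin X ?F"
    using assms by (simp add: closedin_diff)
  have "X interior_of ?F \<inter> U = {}"
    using interior_of_subset[of X ?F] by blast
  then have "X interior_of ?F \<inter> X closure_of U = {}"
    by (simp add: openin_Int_closure_of_eq_empty)
  then have "X interior_of ?F = {}"
    using interior_of_subset[of X ?F] by blast
  then show ?thesis
    using closed by (simp add: nowhere_dense_def closure_of_closedin closedin_subset)
qed

lemma nowhere_dense_subset:
  "nowhere_dense X B \<Longrightarrow> A \<subseteq> B \<Longrightarrow> nowhere_dense X A"
  unfolding nowhere_dense_def
  by (metis closure_of_mono interior_of_mono subset_empty subset_trans)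

text \<open>The open part is the interior of \<open>A\<close>; the remainder lies in the boundary of
  that interior.\<close>

lemma semi_open_imp_simply_open:
  assumes "semi_open X A"
  shows "simply_open X A"
proof -
  have "A - X interior_of A \<subseteq> X closure_of (X interior_of A) - X interior_of A"
    using assms unfolding semi_open_def by blast
  then have "nowhere_dense X (A - X interior_of A)"
    using nowhere_dense_subset nowhere_dense_closure_of_diff openin_interior_of by metis
  moreover have "A = X interior_of A \<union> (A - X interior_of A)"
    using interior_of_subset[of X A] by blast
  ultimately show ?thesis
    unfolding simply_open_def using openin_interior_of by metis
qed

lemma beta_open_simply_open_imp_semi_open:
  assumes "beta_open X A" and "simply_open X A"
  shows "semi_open X A"
proof -
  obtain U N where U: "openin X U" and N: "nowhere_dense X N" and A: "A = U \<union> N"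
    using assms(2) unfolding simply_open_def by blast
  let ?W = "X interior_of (X closure_of A)"
  \<comment> \<open>Closure distributes over \<open>U \<union> N\<close>, so off the closure of
    \<open>U\<close> only \<open>N\<close> contributes. The difference is open inside the closure of
    a nowhere dense set, hence empty.\<close>
  have "?W - X closure_of U \<subseteq> X closure_of N"
    using interior_of_subset[of X "X closure_of A"] by (auto simp: A)
  moreover have "openin X (?W - X closure_of U)"
    by (simp add: openin_diff)
  ultimately have "?W - X closure_of U \<subseteq> X interior_of (X closure_of N)"
    by (simp add: interior_of_maximal)
  then have "?W \<subseteq> X closure_of U"
    using N by (auto simp: nowhere_dense_def)
  then have "X closure_of ?W \<subseteq> X closure_of U"
    by (simp add: closure_of_minimal)
  \<comment> \<open>\<open>U\<close> is an open subset of \<open>A\<close>, so it lies in the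
    interior of \<open>A\<close>.\<close>
  also have "\<dots> \<subseteq> X closure_of (X interior_of A)"
    using U A by (intro closure_of_mono interior_of_maximal) auto
  finally show ?thesis
    using assms(1) unfolding beta_open_def semi_open_def by blast
qed

lemma semi_regular_iff:
  "semi_regular X A \<longleftrightarrow> beta_open X A \<and> simply_open X A \<and> sg_closed X A"
  unfolding semi_regular_def
  using semi_open_imp_beta_open semi_open_imp_simply_open semi_closed_imp_sg_closed
    beta_open_simply_open_imp_semi_open semi_open_sg_closed_imp_semi_closed
  by blast

theorem corollary3p21:
  fixes X :: "'a topology" and Y :: "'b topology" and f :: "'a \<Rightarrow> 'b"
  assumes "f \<in> topspace X \<rightarrow> topspace Y"
  shows "SR_continuous X Y f \<longleftrightarrow>
           beta_continuous X Y f \<and> simply_continuous X Y f \<and> contra_sg_continuous X Y f"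
  unfolding SR_continuous_def beta_continuous_def simply_continuous_def
    contra_sg_continuous_def semi_regular_iff
  by blast

end
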